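(* Let $f\in C[0,1]$, let $(g_n)_{n\in\mathbb N},(h_n)_{n\in\mathbb N}$ be the sequences in $C[0,1]$ associated with $f$ by the recursion for the integral extension, and let $\tilde f$ be the integral extension of $f$. If $f\in C_{\rm even}[0,1]$, then $h_n=g_n=f$ for all $n\in\mathbb N$. If $f\in C_{\rm odd}[0,1]$, then $h_n+g_n=0$ for all $n\in\mathbb N$. Accordingly, $\tilde f\in C_{\rm even}(\mathbb R)$ if $f\in C_{\rm even}[0,1]$, whereas $\tilde f\in C_{\rm odd}(\mathbb R)$ if $f\in C_{\rm odd}[0,1]$.
   Context: $\mathbb N=\{0,1,2,\dots\}$. $C_{\rm even}[0,1]$ and $C_{\rm odd}[0,1]$ are the subspaces of those continuous real-valued $f$ on $[0,1]$ with $f(1-x)=f(x)$, respectively $f(1-x)=-f(x)$, for all $x\in[0,1]$. $C_{\rm even}(\mathbb R)$ and $C_{\rm odd}(\mathbb R)$ are the spaces of continuous functions $f$ on $\mathbb R$ with $f(1-x)=f(x)$, respectively $f(1-x)=-f(x)$, for all $x\in\mathbb R$ (symmetry and asymmetry about $\frac12$). Recursion and integral extension: given $f\in C[0,1]$, define $g_n,h_n\in C[0,1]$, $n\in\mathbb N$, by $g_0(x)=f(x)$, $h_0(x)=f(1-x)$, and $h_{n+1}=g_n-\psi_n$, $g_{n+1}=h_n+\psi_n$, where $d_n=h_n-g_n$ and $\psi_n(x)=-e^{2x}\int_0^1d_n(y)\,dy+2\int_0^xe^{2(x-y)}d_n(y)\,dy$, $x\in[0,1]$. The integral extension $\tilde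 f:\mathbb R\to\mathbb R$ is the (well-defined, continuous) function determined by $\tilde f(x+n)=g_n(x)$ and $\tilde f(1-x-n)=h_n(x)$ for $x\in[0,1]$, $n\in\mathbb N$. *)

theory Defs
  imports "HOL-Analysis.Analysis"
begin

text \<open>
  A function in $C[0,1]$ is represented by a total function on the reals of which only the
  restriction to $[0,1]$ is meaningful: continuity, symmetry and equality of such functions
  are always stated on \<^term>\<open>{0..1::real}\<close> only.
\<close>

definition C_even_01 :: "(real \<Rightarrow> real) set" where
  "C_even_01 = {f. continuous_on {0..1} f \<and> (\<forall>x\<in>{0..1}. f (1 - x) = f x)}"

definition C_odd_01 :: "(real \<Rightarrow> real) set" where
  "C_odd_01 = {f. continuous_on {0..1} f \<and> (\<forall>x\<in>{0..1}. f (1 - x) = - f x)}"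

definition C_even_real :: "(real \<Rightarrow> real) set" where
  "C_even_real = {f. continuous_on UNIV f \<and> (\<forall>x. f (1 - x) = f x)}"

definition C_odd_real :: "(real \<Rightarrow> real) set" where
  "C_odd_real = {f. continuous_on UNIV f \<and> (\<forall>x. f (1 - x) = - f x)}"

definition psi :: "(real \<Rightarrow> real) \<Rightarrow> real \<Rightarrow> real" where
  "psi d x = - exp (2 * x) * integral {0..1} d
             + 2 * integral {0..x} (\<lambda>y. exp (2 * (x - y)) * d y)"

fun g_seq h_seq :: "(real \<Rightarrow> real) \<Rightarrow> nat \<Rightarrow> real \<Rightarrow> real" where
  "g_seq f 0 = (\<lambda>x. f x)"
| "h_seq f 0 = (\<lambda>x. f (1 - x))"
| "g_seq f (Suc n) = (\<lambda>x. h_seq f n x + psi (\<lambda>y. h_seq f n y - g_seq f n y) x)"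
| "h_seq f (Suc n) = (\<lambda>x. g_seq f n x - psi (\<lambda>y. h_seq f n y - g_seq f n y) x)"

definition integral_extension :: "(real \<Rightarrow> real) \<Rightarrow> real \<Rightarrow> real" where
  "integral_extension f =
     (THE F. \<forall>n::nat. \<forall>x\<in>{0..1}.
        F (x + real n) = g_seq f n x \<and> F (1 - x - real n) = h_seq f n x)"

text \<open>
  The remainder shows that the defining conditions of \<^const>\<open>integral_extension\<close> determine a
  unique function whenever \<open>f\<close> is continuous on $[0,1]$, so that the definite description is
  justified.
\<close>

lemma psi_alt:
  "psi d x = exp (2 * x) * (2 * integral {0..x} (\<lambda>y. exp (- 2 * y) * d y) - integral {0..1} d)"
proof -
  have "exp (2 * (x - y)) * d y = exp (2 * x) * (exp (- 2 * y) * d y)" for y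
  proof -
    have "2 * (x - y) = 2 * x + - 2 * y" by simp
    then have "exp (2 * (x - y)) = exp (2 * x) * exp (- 2 * y)" by (simp only: exp_add)
    then show ?thesis by (simp only: mult.assoc)
  qed
  then have "integral {0..x} (\<lambda>y. exp (2 * (x - y)) * d y)
      = exp (2 * x) * integral {0..x} (\<lambda>y. exp (- 2 * y) * d y)"
    by (simp only: integral_mult_right)
  then show ?thesis unfolding psi_def by algebra
qed

lemma psi_deriv:
  assumes "continuous_on {0..1} d" "x \<in> {0..1}"
  shows "(psi d has_real_derivative 2 * psi d x + 2 * d x) (at x within {0..1})"
proof -
  have "continuous_on {0..1} (\<lambda>y. exp (- 2 * y) * d y)"
    using assms(1) by (intro continuous_intros)
  note I = integral_has_real_derivative[OF this assms(2)]
  have E: "((\<lambda>x. exp (2 * x)) has_real_derivative 2 * exp (2 * x)) (at x within {0..1})"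
    by (auto intro!: derivative_eq_intros)
  have "exp (2 * x) * exp (- 2 * x) = 1"
    by (simp add: mult_exp_exp)
  then have eq: "2 * exp (2 * x) * (2 * integral {0..x} (\<lambda>y. exp (- 2 * y) * d y) - integral {0..1} d)
      + (2 * (exp (- 2 * x) * d x) - 0) * exp (2 * x) = 2 * psi d x + 2 * d x"
    unfolding psi_alt by algebra
  have "((\<lambda>x. exp (2 * x) * (2 * integral {0..x} (\<lambda>y. exp (- 2 * y) * d y) - integral {0..1} d))
    has_real_derivative 2 * psi d x + 2 * d x) (at x within {0..1})"
    using DERIV_mult[OF E DERIV_diff[OF DERIV_cmult[OF I, of 2] DERIV_const[of "integral {0..1} d"]]]
    unfolding eq .
  moreover have "psi d = (\<lambda>x. exp (2 * x) *
      (2 * integral {0..x} (\<lambda>y. exp (- 2 * y) * d y) - integral {0..1} d))"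
    by (rule ext) (rule psi_alt)
  ultimately show ?thesis by simp
qed

lemma continuous_on_psi:
  assumes "continuous_on {0..1} d"
  shows "continuous_on {0..1} (psi d)"
  using DERIV_continuous[OF psi_deriv[OF assms]]
  by (simp add: continuous_on_eq_continuous_within)

lemma integral_psi:
  assumes "continuous_on {0..1} d"
  shows "2 * integral {0..1} (psi d) = psi d 1 - psi d 0 - 2 * integral {0..1} d"
proof -
  have A: "((\<lambda>x. 2 * psi d x + 2 * d x) has_integral psi d 1 - psi d 0) {0..1}"
    by (rule fundamental_theorem_of_calculus)
       (simp_all add: psi_deriv[OF assms] flip: has_real_derivative_iff_has_vector_derivative)
  have B: "((\<lambda>x. 2 * psi d x + 2 * d x) has_integral
      2 * integral {0..1} (psi d) + 2 * integral {0..1} d) {0..1}"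
    by (intro has_integral_add has_integral_mult_right integrable_integral
        integrable_continuous_real continuous_on_psi assms)
  from has_integral_unique[OF A B] show ?thesis by simp
qed

lemma continuous_on_g_h:
  assumes "continuous_on {0..1} f"
  shows "continuous_on {0..1} (g_seq f n) \<and> continuous_on {0..1} (h_seq f n)"
proof (induction n)
  case 0
  have "continuous_on {0..1} (\<lambda>x. f (1 - x))"
    by (rule continuous_on_compose2[OF assms]) (auto intro!: continuous_intros)
  with assms show ?case by simp
next
  case (Suc n)
  then have "continuous_on {0..1} (psi (\<lambda>y. h_seq f n y - g_seq f n y))"
    by (intro continuous_on_psi continuous_on_diff) simp_all
  with Suc show ?case by (simp add: continuous_on_add continuous_on_diff)
qed

lemma g_h_junction:
  assumes "continuous_on {0..1} f"
  shows "g_seq f (Suc n) 0 = g_seq f n 1 \<and> h_seq f (Suc n) 0 = h_seq f n 1"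
proof (induction n)
  case 0
  have fi: "(f has_integral integral {0..1} f) (cbox 0 1)"
    using integrable_continuous_real[OF assms] by (simp add: integrable_integral)
  have img: "(\<lambda>x::real. - x + 1) ` {0..1} = {0..1}"
    using image_affinity_atLeastAtMost[of "-1 :: real" 1 0 1] by simp
  have "((\<lambda>x. f (1 - x)) has_integral integral {0..1} f) {0..1}"
    using has_integral_affinity[OF fi, of "-1" 1] img by (simp add: algebra_simps)
  then have "((\<lambda>x. f (1 - x) - f x) has_integral integral {0..1} f - integral {0..1} f) {0..1}"
    by (intro has_integral_diff integrable_integral integrable_continuous_real assms)
  then have "integral {0..1} (\<lambda>x. f (1 - x) - f x) = 0"
    by (auto intro: integral_unique)
  then show ?case by (simp add: psi_def)
next
  case (Suc n)
  define d where "d = (\<lambda>y. h_seq f n y - g_seq f n y)"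
  have d: "continuous_on {0..1} d"
    using continuous_on_g_h[OF assms] unfolding d_def by (intro continuous_intros) auto
  define D where "D = integral {0..1} (\<lambda>y. h_seq f (Suc n) y - g_seq f (Suc n) y)"
  have eq: "(\<lambda>y. h_seq f (Suc n) y - g_seq f (Suc n) y) = (\<lambda>y. - d y - 2 * psi d y)"
    by (auto simp: d_def)
  have "((\<lambda>y. - d y - 2 * psi d y) has_integral
      - integral {0..1} d - 2 * integral {0..1} (psi d)) {0..1}"
    by (intro has_integral_diff has_integral_neg has_integral_mult_right integrable_integral
        integrable_continuous_real continuous_on_psi d)
  then have "D = - integral {0..1} d - 2 * integral {0..1} (psi d)"
    unfolding D_def eq by (rule integral_unique)
  then have D: "D = - psi d 1"
    using integral_psi[OF d] by (simp add: psi_def)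
  have "g_seq f (Suc (Suc n)) 0 = h_seq f (Suc n) 0 - D"
       "h_seq f (Suc (Suc n)) 0 = g_seq f (Suc n) 0 + D"
    unfolding D_def
    by (subst g_seq.simps h_seq.simps; simp add: psi_def del: g_seq.simps h_seq.simps)+
  moreover have "g_seq f (Suc n) 1 = h_seq f n 1 + psi d 1"
                "h_seq f (Suc n) 1 = g_seq f n 1 - psi d 1"
    by (simp_all add: d_def)
  ultimately show ?case using Suc D by simp
qed

lemma integral_extension_ex1:
  assumes "continuous_on {0..1} f"
  shows "\<exists>!F. \<forall>n::nat. \<forall>x\<in>{0..1}.
           F (x + real n) = g_seq f n x \<and> F (1 - x - real n) = h_seq f n x"
proof (rule ex_ex1I)
  define glue where "glue = (\<lambda>(u :: nat \<Rightarrow> real \<Rightarrow> real) s. u (nat \<lfloor>s\<rfloor>) (frac s))"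
  have glue: "glue u (x + real n) = u n x"
    if u: "\<And>n. u (Suc n) 0 = u n 1" and x: "x \<in> {0..1}" for u n and x :: real
  proof (cases "x = 1")
    case True
    have fl: "\<lfloor>1 + real n\<rfloor> = int (Suc n)" by linarith
    have "frac (1 + real n) = 0" by (simp add: frac_def fl)
    then have "glue u (1 + real n) = u (Suc n) 0"
      by (simp only: glue_def fl nat_int)
    then show ?thesis using True u by simp
  next
    case False
    then have "\<lfloor>x + real n\<rfloor> = int n" using x by (simp add: floor_eq_iff)
    then show ?thesis by (simp add: glue_def frac_def)
  qed
  note g = glue[of "g_seq f", OF conjunct1[OF g_h_junction[OF assms]]]
  note h = glue[of "h_seq f", OF conjunct2[OF g_h_junction[OF assms]]]
  define F where "F = (\<lambda>t. if t \<ge> 0 then glue (g_seq f) t else glue (h_seq f) (1 - t))"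
  have "F (x + real n) = g_seq f n x" if "x \<in> {0..1}" for n x
    using g[OF that] that by (simp add: F_def)
  moreover have "F (1 - x - real n) = h_seq f n x" if x: "x \<in> {0..1}" for n x
  proof (cases "1 - x - real n < 0")
    case True
    then show ?thesis using h[OF x, of n] by (simp add: F_def)
  next
    case False
    then have "n = 0 \<or> n = 1 \<and> x = 0" using x by (cases n) auto
    then show ?thesis
    proof
      assume "n = 0"
      then show ?thesis using g[of "1 - x" 0] x by (simp add: F_def)
    next
      assume "n = 1 \<and> x = 0"
      then show ?thesis
        using g[of 0 0] g_h_junction[OF assms, of 0] by (simp add: F_def)
    qed
  qed
  ultimately show "\<exists>F. \<forall>n::nat. \<forall>x\<in>{0..1}.
      F (x + real n) = g_seq f n x \<and> F (1 - x - real n) = h_seq f n x"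
    by blast
next
  fix F G :: "real \<Rightarrow> real"
  assume F: "\<forall>n::nat. \<forall>x\<in>{0..1}.
      F (x + real n) = g_seq f n x \<and> F (1 - x - real n) = h_seq f n x"
    and G: "\<forall>n::nat. \<forall>x\<in>{0..1}.
      G (x + real n) = g_seq f n x \<and> G (1 - x - real n) = h_seq f n x"
  show "F = G"
  proof
    fix t :: real
    have split: "frac s \<in> {0..1} \<and> s = frac s + real (nat \<lfloor>s\<rfloor>)" if "s \<ge> 0" for s :: real
      using that frac_lt_1[of s] by (auto simp: frac_def)
    show "F t = G t"
    proof (cases "t \<ge> 0")
      case True
      then show ?thesis using split[of t] F G by metis
    next
      case False
      then have s: "frac (1 - t) \<in> {0..1}"
          "t = 1 - frac (1 - t) - real (nat \<lfloor>1 - t\<rfloor>)"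
        using split[of "1 - t"] by linarith+
      then show ?thesis using F G by metis
    qed
  qed
qed

lemma integral_extension:
  assumes "continuous_on {0..1} f" "x \<in> {0..1}"
  shows "integral_extension f (x + real n) = g_seq f n x"
    and "integral_extension f (1 - x - real n) = h_seq f n x"
proof -
  have "\<forall>n::nat. \<forall>x\<in>{0..1}. integral_extension f (x + real n) = g_seq f n x \<and>
      integral_extension f (1 - x - real n) = h_seq f n x"
    unfolding integral_extension_def by (rule theI'[OF integral_extension_ex1[OF assms(1)]])
  then show "integral_extension f (x + real n) = g_seq f n x"
    and "integral_extension f (1 - x - real n) = h_seq f n x"
    using assms(2) by simp_all
qed

end

theory Submission
  imports Defs
begin

text \<open>The correction \<open>psi\<close> depends linearly on the difference
  \<open>h_seq f n - g_seq f n\<close> and enters the two recursions with opposite signs. For even f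
  the difference starts at zero, so the correction vanishes and nothing ever changes. For odd f the
  correction cancels in the sum of the two sequences, which thus keeps its initial value f(1 - x) +
  f(x) = 0 (\<open>h_seq_plus_g_seq\<close>). Since 1 - (x + n) = 1 - x - n, reflection about 1/2
  swaps the pieces \<open>g_seq f n\<close> and \<open>h_seq f n\<close> of the extension, so these
  relations become its symmetry (\<open>integral_extension_reflect\<close>); continuity is glued
  from unit intervals.\<close>

lemma psi_eq_0:
  assumes "\<And>y. y \<in> {0..1} \<Longrightarrow> d y = 0" "x \<in> {0..1}"
  shows "psi d x = 0"
proof -
  have "integral {0..1} d = 0"
    using assms(1) integral_cong[of "{0..1}" d "\<lambda>_. 0"] by simp
  moreover have "integral {0..x} (\<lambda>y. exp (2 * (x - y)) * d y) = 0"
    using assms integral_cong[of "{0..x}" "\<lambda>y. exp (2 * (x - y)) * d y" "\<lambda>_. 0"] by simp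
  ultimately show ?thesis by (simp add: psi_def)
qed

lemma g_h_seq_even:
  assumes "\<And>x. x \<in> {0..1} \<Longrightarrow> f (1 - x) = f x" "x \<in> {0..1}"
  shows "g_seq f n x = f x \<and> h_seq f n x = f x"
  using assms(2)
\<comment> \<open>The value of \<open>psi\<close> at x involves integrals over all of [0,1], so the
  induction hypothesis is needed at every point, not only at x.\<close>
proof (induction n arbitrary: x)
  case 0
  then show ?case using assms(1) by simp
next
  case (Suc n)
  then have "psi (\<lambda>y. h_seq f n y - g_seq f n y) x = 0"
    by (intro psi_eq_0) auto
  with Suc show ?case by simp
qed

lemma h_seq_plus_g_seq: "h_seq f n x + g_seq f n x = f (1 - x) + f x"
  by (induction n) simp_all

text \<open>Two adjacent closed unit intervals always cover a neighbourhood of a given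
  point.\<close>

lemma continuous_on_unit_intervals:
  fixes F :: "real \<Rightarrow> 'a::topological_space"
  assumes "\<And>m::int. continuous_on {of_int m..of_int m + 1} F"
  shows "continuous_on UNIV F"
proof -
  have "isCont F t" for t
  proof -
    define m where "m = \<lfloor>t\<rfloor>"
    \<comment> \<open>The left neighbour is included because t may equal the integer m.\<close>
    have "continuous_on ({of_int (m - 1)..of_int (m - 1) + 1} \<union> {of_int m..of_int m + 1}) F"
      by (intro continuous_on_closed_Un assms) auto
    moreover have "{of_int m - 1<..<of_int m + 1}
        \<subseteq> {of_int (m - 1)..of_int (m - 1) + 1} \<union> {of_int m..of_int m + 1 :: real}"
      by auto
    ultimately have "continuous_on {of_int m - 1<..<of_int m + 1} F"
      by (rule continuous_on_subset)
    moreover have "t \<in> {of_int m - 1<..<of_int m + 1}"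
      unfolding m_def greaterThanLessThan_iff by linarith
    ultimately show ?thesis
      by (simp add: continuous_on_eq_continuous_at)
  qed
  then show ?thesis by (simp add: continuous_on_eq_continuous_at)
qed

text \<open>On each closed unit interval, endpoints included, the extension is a translate of some
  \<open>g_seq f n\<close> or a reflected translate of some \<open>h_seq f n\<close>.\<close>

lemma continuous_on_integral_extension:
  assumes "continuous_on {0..1} f"
  shows "continuous_on UNIV (integral_extension f)"
proof (rule continuous_on_unit_intervals)
  fix m :: int
  show "continuous_on {of_int m..of_int m + 1} (integral_extension f)"
  proof (cases "m \<ge> 0")
    case True
    then have m: "real_of_int m = real (nat m)" by simp
    have "continuous_on {real (nat m)..real (nat m) + 1} (\<lambda>t. g_seq f (nat m) (t - real (nat m)))"
      by (rule continuous_on_compose2[OF conjunct1[OF continuous_on_g_h[OF assms]]])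
         (auto intro!: continuous_intros)
    moreover have "integral_extension f t = g_seq f (nat m) (t - real (nat m))"
      if "t \<in> {real (nat m)..real (nat m) + 1}" for t
      using integral_extension(1)[OF assms, of "t - real (nat m)" "nat m"] that by simp
    ultimately show ?thesis
      unfolding m by (metis (no_types, lifting) continuous_on_cong)
  next
    case False
    then have m: "real_of_int m = - real (nat (- m))" by simp
    define n where "n = nat (- m)"
    \<comment> \<open>The argument of \<open>h_seq f n\<close> comes from solving t = 1 - x - n for
      x.\<close>
    have "continuous_on {- real n..- real n + 1} (\<lambda>t. h_seq f n (1 - t - real n))"
      by (rule continuous_on_compose2[OF conjunct2[OF continuous_on_g_h[OF assms]]])
         (auto intro!: continuous_intros)
    moreover have "integral_extension f t = h_seq f n (1 - t - real n)"
      if "t \<in> {- real n..- real n + 1}" for t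
      using integral_extension(2)[OF assms, of "1 - t - real n" n] that by simp
    ultimately show ?thesis
      unfolding m n_def[symmetric] by (metis (no_types, lifting) continuous_on_cong)
  qed
qed

text \<open>The sign c treats both symmetries at once: c = 1 is the even case, c = -1 the odd
  one.\<close>

lemma integral_extension_reflect:
  assumes f: "continuous_on {0..1} f" and "c * c = 1"
    and hg: "\<And>n x. x \<in> {0..1} \<Longrightarrow> h_seq f n x = c * g_seq f n x"
  shows "integral_extension f (1 - t) = c * integral_extension f t"
proof -
  have *: "integral_extension f (1 - s) = c * integral_extension f s" if "s \<ge> 0" for s
  proof -
    define n where "n = nat \<lfloor>s\<rfloor>"
    have x: "frac s \<in> {0..1}" and s: "s = frac s + real n"
      using that frac_lt_1[of s] by (auto simp: n_def frac_def)
    have "1 - s = 1 - frac s - real n" using s by linarith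
    then show ?thesis
      using integral_extension[OF f x, of n] hg[OF x, of n] s by metis
  qed
  show ?thesis
  proof (cases "t \<ge> 0")
    case True
    then show ?thesis by (rule *)
  next
    case False
    \<comment> \<open>For t < 0 the point 1 - t is positive; multiplying its identity by c inverts
      the relation.\<close>
    then have "integral_extension f t = c * integral_extension f (1 - t)"
      using *[of "1 - t"] by simp
    then show ?thesis using \<open>c * c = 1\<close> by (simp flip: mult.assoc)
  qed
qed

theorem lemma3p1:
  fixes f :: "real \<Rightarrow> real"
  assumes "continuous_on {0..1} f"
  shows "(f \<in> C_even_01 \<longrightarrow>
            (\<forall>n. \<forall>x\<in>{0..1}. h_seq f n x = g_seq f n x \<and> g_seq f n x = f x)) \<and>
         (f \<in> C_odd_01 \<longrightarrow> (\<forall>n. \<forall>x\<in>{0..1}. h_seq f n x + g_seq f n x = 0)) \<and>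
         (f \<in> C_even_01 \<longrightarrow> integral_extension f \<in> C_even_real) \<and>
         (f \<in> C_odd_01 \<longrightarrow> integral_extension f \<in> C_odd_real)"
proof -
  have even: "h_seq f n x = g_seq f n x \<and> g_seq f n x = f x"
    if "f \<in> C_even_01" "x \<in> {0..1}" for n x
    using g_h_seq_even[of f x n] that by (simp add: C_even_01_def)
  have odd: "h_seq f n x + g_seq f n x = 0" if "f \<in> C_odd_01" "x \<in> {0..1}" for n x
    using that by (simp add: h_seq_plus_g_seq C_odd_01_def)
  have "integral_extension f \<in> C_even_real" if "f \<in> C_even_01"
    using integral_extension_reflect[OF assms, of 1] even[OF that]
      continuous_on_integral_extension[OF assms]
    by (simp add: C_even_real_def)
  moreover have "integral_extension f \<in> C_odd_real" if "f \<in> C_odd_01"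
    using integral_extension_reflect[OF assms, of "-1"] odd[OF that]
      continuous_on_integral_extension[OF assms]
    by (simp add: C_odd_real_def eq_neg_iff_add_eq_0)
  ultimately show ?thesis using even odd by blast
qed

end
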